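(* For any $\alpha>0$, there exist a real matrix $X$ with $N$ columns and a vector $w\in\mathbb{R}^N$ such that, with $\lambda=\alpha\|X\|_F^2/N>0$, when OPTQ is applied to $X$ and $w$ with regularization parameter $\lambda$ (i.e. with Hessian $H=X^\top X+\lambda I$), it produces a quantized vector $q$ satisfying $$\|w-q\|_\infty\gtrsim\sqrt{N},\qquad\|X(w-q)\|_\infty\gtrsim\sqrt{N}$$ when $\alpha$ is small compared to $N$. This holds despite $$\|X\|_{\mathrm{op}}=O(1),\qquad\|w\|_\infty\le\tfrac12 .$$ This is an existential statement for each fixed $\alpha$; it does not describe the behavior of OPTQ on a fixed instance as $\alpha$ varies.
   Context: $\|\cdot\|_{\mathrm{op}}$ is the spectral norm and $\|\cdot\|_F$ the Frobenius norm; $\gtrsim$ and $O(\cdot)$ are the usual notations hiding constant factors. Quantizer: the alphabet is $\mathbb{Z}$ (infinite alphabet with step size $1$) and $\mathcal{Q}(z)=\arg\min_{p\in\mathbb{Z}}|z-p|$ (round to nearest). OPTQ with an invertible symmetric positive definite Hessian $H\in\mathbb{R}^{N\times N}$, applied to $w\in\mathbb{R}^N$: let $H^{-1}=LL^\top$ be the Cholesky decomposition ($L$ lower triangular). Set $w^{(0)}=w$. For $t=1,\dots,N$: set $q_t=\mathcal{Q}(w^{(t-1)}_t)$ and $w^{(t)}_{\ge t+1}=w^{(t-1)}_{\ge t+1}+(q_t-w^{(t-1)}_t)\,L_{\ge t+1,t}/L_{tt}$, where $v_{\ge j}=(v_j,\dots,v_N)^\top$ and $L_{\ge t+1,t}$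 is the part of the $t$-th column of $L$ below the diagonal. The output is $q=(q_1,\dots,q_N)^\top$. *)

theory Defs
  imports Complex_Main "Jordan_Normal_Form.Matrix"
begin

definition l2_norm_vec :: "real vec \<Rightarrow> real" where
  "l2_norm_vec v = sqrt (\<Sum>i<dim_vec v. (v $ i)\<^sup>2)"

(* The inserted 0 only matters for the empty vector. *)
definition linf_norm_vec :: "real vec \<Rightarrow> real" where
  "linf_norm_vec v = Max (insert 0 ((\<lambda>i. \<bar>v $ i\<bar>) ` {..<dim_vec v}))"

definition frobenius_norm :: "real mat \<Rightarrow> real" where
  "frobenius_norm A = sqrt (\<Sum>i<dim_row A. \<Sum>j<dim_col A. (A $$ (i, j))\<^sup>2)"

definition spectral_norm :: "real mat \<Rightarrow> real" where
  "spectral_norm A =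
     Sup {l2_norm_vec (A *\<^sub>v v) | v. v \<in> carrier_vec (dim_col A) \<and> l2_norm_vec v \<le> 1}"

(* Ties are broken in an unspecified way (by the choice operator inside arg_min). *)
definition quantize :: "real \<Rightarrow> int" where
  "quantize z = arg_min (\<lambda>p::int. \<bar>z - of_int p\<bar>) (\<lambda>_. True)"

(* The positive diagonal makes the Cholesky factor unique. *)
definition is_cholesky_factor :: "real mat \<Rightarrow> real mat \<Rightarrow> bool" where
  "is_cholesky_factor A L \<longleftrightarrow>
     L \<in> carrier_mat (dim_row A) (dim_row A) \<and>
     (\<forall>i<dim_row A. \<forall>j<dim_row A. i < j \<longrightarrow> L $$ (i, j) = 0) \<and>
     (\<forall>i<dim_row A. L $$ (i, i) > 0) \<and>
     A = L * L\<^sup>T"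

(* optq_state L w t is the vector w^(t). Indices start at 0, so the step from t to Suc t
   treats coordinate t, which is coordinate t+1 in 1-based numbering. The algorithm specifies
   w^(t) only on the coordinates not yet quantized; the others are never read again and
   are kept unchanged. *)
fun optq_state :: "real mat \<Rightarrow> real vec \<Rightarrow> nat \<Rightarrow> real vec" where
  "optq_state L w 0 = w"
| "optq_state L w (Suc t) =
     (let v = optq_state L w t in
      vec (dim_vec w) (\<lambda>i.
        if t < i
        then v $ i + (of_int (quantize (v $ t)) - v $ t) * (L $$ (i, t) / L $$ (t, t))
        else v $ i))"

definition optq_result :: "real mat \<Rightarrow> real vec \<Rightarrow> real vec" where
  "optq_result L w = vec (dim_vec w) (\<lambda>t. of_int (quantize (optq_state L w t $ t)))"

(* optq H w q: OPTQ with Hessian H, applied to w, outputs q. At most one q satisfies this,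
   since the inverse Hinv and its Cholesky factor L are unique. *)
definition optq :: "real mat \<Rightarrow> real vec \<Rightarrow> real vec \<Rightarrow> bool" where
  "optq H w q \<longleftrightarrow>
     (\<exists>Hinv L. H \<in> carrier_mat (dim_vec w) (dim_vec w) \<and>
        inverts_mat H Hinv \<and> inverts_mat Hinv H \<and>
        is_cholesky_factor Hinv L \<and> q = optq_result L w)"

end

theory Submission
  imports Defs "HOL-Analysis.Convex"
begin

text \<open>
  Take \<open>X\<close> to be the row \<open>x = (1/\<surd>N, \<dots>, 1/\<surd>N, 1)\<close> stacked on top of \<open>\<beta>I\<close> with
  \<open>\<beta>\<^sup>2 = 1/(1 + \<alpha>)\<close>. Then \<open>H = \<mu>I + x x\<^sup>T\<close> with \<open>\<mu> = 1 + \<alpha>\<bar>x\<bar>\<^sup>2/N\<close>, which lies in \<open>[1, 3]\<close>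
  for all \<open>\<alpha> \<le> N\<close>, and the Cholesky factor of \<open>H\<^sup>-\<^sup>1\<close> is explicit. Choosing \<open>w\<close> such that every
  rounding error equals \<open>1/4\<close>, all earlier errors add up in the last coordinate, and the same
  sum up to one term, times \<open>\<mu>/4\<close>, is \<open>x \<bullet> (w - q)\<close>. Each of its \<open>N\<close> terms is at least \<open>1/(5\<surd>N)\<close>.
\<close>

section \<open>Rounding to nearest and prescribed rounding errors\<close>

text \<open>The strict bound excludes ties, so the choice inside \<open>arg_min\<close> has a single
  candidate.\<close>

lemma quantize_near:
  assumes "\<bar>z - of_int k\<bar> < 1 / 2"
  shows "quantize z = k"
proof -
  have closer: "\<bar>z - of_int k\<bar> < \<bar>z - of_int p\<bar>" if "p \<noteq> k" for p :: int
  proof -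
    have "1 \<le> \<bar>real_of_int p - real_of_int k\<bar>" using that by linarith
    then show ?thesis using assms by linarith
  qed
  have "is_arg_min (\<lambda>p::int. \<bar>z - of_int p\<bar>) (\<lambda>_. True) (quantize z)"
    unfolding quantize_def arg_min_def
    by (rule someI[of _ k]) (use closer in \<open>force simp: is_arg_min_def\<close>)
  then show ?thesis
    using closer unfolding is_arg_min_def by blast
qed

text \<open>OPTQ's error is \<open>L D\<^sup>-\<^sup>1 d\<close> where \<open>D\<close> is the diagonal of \<open>L\<close> and \<open>d\<close> collects the
  rounding errors. Since each weight can be adjusted modulo 1, \<open>d\<close> can be prescribed.\<close>

lemma optq_rounding_errors_prescribed:
  fixes L :: "real mat" and d :: "nat \<Rightarrow> real"
  assumes d: "\<And>i. i < N \<Longrightarrow> \<bar>d i\<bar> < 1 / 2" and L: "\<And>i. i < N \<Longrightarrow> L $$ (i, i) \<noteq> 0"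
  obtains w where "w \<in> carrier_vec N" "\<And>i. i < N \<Longrightarrow> \<bar>w $ i\<bar> \<le> 1 / 2"
    "\<And>i. i < N \<Longrightarrow>
      (w - optq_result L w) $ i = d i + (\<Sum>s<i. d s * (L $$ (i, s) / L $$ (s, s)))"
proof -
  define e where "e i = d i + (\<Sum>s<i. d s * (L $$ (i, s) / L $$ (s, s)))" for i
  \<comment> \<open>Removing the nearest integer brings \<open>w\<close> into the box. The same
    integer shift passes to the quantized value, so the rounding errors do not change.\<close>
  define w where "w = vec N (\<lambda>i. e i - of_int (round (e i)))"
  have wi: "w $ i = e i - of_int (round (e i))" if "i < N" for i
    using that by (simp add: w_def)
  have dim: "dim_vec w = N" by (simp add: w_def)
  have quant: "quantize (d i - of_int (round (e i))) = - round (e i)" if "i < N" for i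
    using d[OF that] by (intro quantize_near) simp
  \<comment> \<open>Step \<open>s\<close> alters only coordinates above \<open>s\<close>, so
    coordinate \<open>i\<close> is frozen after \<open>i\<close> steps; hence
    \<open>min t i\<close>.\<close>
  have state: "optq_state L w t $ i =
      w $ i - (\<Sum>s<min t i. d s * (L $$ (i, s) / L $$ (s, s)))" if "t \<le> N" "i < N" for t i
    using that
  proof (induction t arbitrary: i)
    case (Suc t)
    have t: "optq_state L w t $ t = d t - of_int (round (e t))"
      using Suc.IH[of t] Suc.prems by (simp add: wi e_def)
    show ?case
    proof (cases "t < i")
      case True
      then have "min (Suc t) i = Suc t" "min t i = t" by auto
      moreover have "real_of_int (quantize (optq_state L w t $ t)) - optq_state L w t $ t = - d t"
        unfolding t using quant[of t] Suc.prems by simp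
      ultimately show ?thesis
        using Suc True by (simp add: Let_def dim)
    next
      case False
      then have "min (Suc t) i = min t i" by auto
      then show ?thesis using Suc False by (simp add: Let_def dim)
    qed
  qed simp
  have "(w - optq_result L w) $ i = e i" if "i < N" for i
  proof -
    have "optq_state L w i $ i = d i - of_int (round (e i))"
      using state[of i i] that by (simp add: wi e_def)
    then show ?thesis
      using that quant[OF that] by (simp add: optq_result_def dim wi)
  qed
  moreover have "\<bar>w $ i\<bar> \<le> 1 / 2" if "i < N" for i
    using of_int_round_abs_le[of "e i"] by (simp add: wi that abs_minus_commute)
  moreover have "w \<in> carrier_vec N" by (simp add: w_def)
  ultimately show thesis using that by (simp add: e_def)
qed

text \<open>With \<open>P s = tail_mass \<mu> x N s\<close>, the trailing block \<open>\<mu>I + x x\<^sup>T\<close> on the coordinates \<open>\<ge> s\<close> has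
  determinant \<open>\<mu>\<^bsup>N - s - 1\<^esup> P s\<close>, and Sherman--Morrison gives its inverse; this is where the
  entries of \<open>rank_one_inv\<close> and \<open>rank_one_chol\<close> come from.\<close>

definition tail_mass :: "real \<Rightarrow> (nat \<Rightarrow> real) \<Rightarrow> nat \<Rightarrow> nat \<Rightarrow> real" where
  "tail_mass \<mu> x N s = \<mu> + (\<Sum>j=s..<N. (x j)\<^sup>2)"

section \<open>Recurrence, bounds and summation identities for the tail masses\<close>

lemma tail_mass_Suc: "s < N \<Longrightarrow> tail_mass \<mu> x N s = tail_mass \<mu> x N (Suc s) + (x s)\<^sup>2"
  by (simp add: tail_mass_def sum.atLeast_Suc_lessThan)

lemma tail_mass_end [simp]: "tail_mass \<mu> x N N = \<mu>"
  by (simp add: tail_mass_def)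

lemma tail_mass_ge: "\<mu> \<le> tail_mass \<mu> x N s"
  by (simp add: tail_mass_def sum_nonneg)

lemma tail_mass_le: "tail_mass \<mu> x N s \<le> \<mu> + (\<Sum>j<N. (x j)\<^sup>2)"
  unfolding tail_mass_def by (intro add_left_mono sum_mono2) auto

text \<open>By the recurrence, \<open>(x s)^2\<close> is the difference of the two factors in the
  denominator, so each term is a difference of reciprocals. Such sums arise when the Cholesky factor
  is multiplied by its transpose.\<close>

lemma sum_telescope_tail_mass:
  assumes "\<mu> > 0" "i \<le> N"
  shows "(\<Sum>s<i. (x s)\<^sup>2 / (tail_mass \<mu> x N s * tail_mass \<mu> x N (Suc s)))
    = 1 / tail_mass \<mu> x N i - 1 / tail_mass \<mu> x N 0"
  using assms(2)
proof (induction i)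
  case (Suc i)
  have pos: "tail_mass \<mu> x N s > 0" for s
    using tail_mass_ge[of \<mu> x N s] assms(1) by linarith
  have "(x i)\<^sup>2 / (tail_mass \<mu> x N i * tail_mass \<mu> x N (Suc i))
      = 1 / tail_mass \<mu> x N (Suc i) - 1 / tail_mass \<mu> x N i"
    using tail_mass_Suc[of i N \<mu> x] Suc.prems pos[of i] pos[of "Suc i"]
    by (simp add: field_simps)
  then show ?case using Suc by simp
qed simp

text \<open>Let \<open>S n\<close> be the sum on the right. Adding
  \<open>x n * (1 - x n * S n)\<close> to \<open>P n * S n\<close> gives
  \<open>P (Suc n) * S n + x n\<close>, which is \<open>P (Suc n) * S (Suc n)\<close>. At
  \<open>n = N\<close> this evaluates the inner product of \<open>x\<close> with the OPTQ error, up
  to the factor 1/4.\<close>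

lemma sum_weighted_error:
  assumes "\<mu> > 0" "n \<le> N"
  shows "(\<Sum>i<n. x i * (1 - x i * (\<Sum>s<i. x s / tail_mass \<mu> x N (Suc s))))
    = tail_mass \<mu> x N n * (\<Sum>s<n. x s / tail_mass \<mu> x N (Suc s))"
  using assms(2)
proof (induction n)
  case (Suc n)
  have "tail_mass \<mu> x N (Suc n) > 0"
    using tail_mass_ge[of \<mu> x N "Suc n"] assms(1) by linarith
  then show ?case
    using Suc tail_mass_Suc[of n N \<mu> x] by (simp add: field_simps power2_eq_square)
qed simp

section \<open>Inverse and Cholesky factor for a rank-one update of a multiple of the
  identity\<close>

definition rank_one_inv :: "real \<Rightarrow> (nat \<Rightarrow> real) \<Rightarrow> nat \<Rightarrow> real mat" where
  "rank_one_inv \<mu> x N = mat N N (\<lambda>(i, j).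
     ((if i = j then 1 else 0) - x i * x j / tail_mass \<mu> x N 0) / \<mu>)"

text \<open>The square root is the diagonal entry; its square is the ratio of the determinants of
  consecutive trailing blocks. Factoring it out of each column exposes the ratios to the diagonal,
  which are all that OPTQ uses.\<close>

definition rank_one_chol :: "real \<Rightarrow> (nat \<Rightarrow> real) \<Rightarrow> nat \<Rightarrow> real mat" where
  "rank_one_chol \<mu> x N = mat N N (\<lambda>(i, s).
     sqrt (tail_mass \<mu> x N (Suc s) / (\<mu> * tail_mass \<mu> x N s)) *
     (if i < s then 0 else if i = s then 1 else - x i * x s / tail_mass \<mu> x N (Suc s)))"

definition rank_one_mat :: "real \<Rightarrow> (nat \<Rightarrow> real) \<Rightarrow> nat \<Rightarrow> real mat" where
  "rank_one_mat \<mu> x N = mat N N (\<lambda>(i, j). (if i = j then \<mu> else 0) + x i * x j)"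

lemma rank_one_mat_inverse:
  assumes "\<mu> > 0"
  shows "rank_one_mat \<mu> x N * rank_one_inv \<mu> x N = 1\<^sub>m N"
    and "rank_one_inv \<mu> x N * rank_one_mat \<mu> x N = 1\<^sub>m N"
proof -
  define P where "P = tail_mass \<mu> x N 0"
  have S: "(\<Sum>k<N. x k * x k) = P - \<mu>"
    by (simp add: P_def tail_mass_def power2_eq_square atLeast0LessThan)
  have S_scaled: "(\<Sum>k<N. c * (x k * x k)) = c * (P - \<mu>)" for c
    by (simp add: S flip: sum_distrib_left)
  have P: "P > 0" using tail_mass_ge[of \<mu> x N 0] assms by (simp add: P_def)
  have *: "(\<Sum>k<N. ((if i = k then \<mu> else 0) + x i * x k) *
        (((if k = j then 1 else 0) - x k * x j / P) / \<mu>)) = (if i = j then 1 else 0)"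
    if "i < N" "j < N" for i j
  proof -
    \<comment> \<open>Expanding separates two Kronecker-delta terms from a multiple of
      \<open>x k * x k\<close>, whose sum is \<open>P - \<mu>\<close>.\<close>
    have "(\<Sum>k<N. ((if i = k then \<mu> else 0) + x i * x k) *
        (((if k = j then 1 else 0) - x k * x j / P) / \<mu>))
      = (\<Sum>k<N. (if i = k then (if k = j then 1 else 0) - x k * x j / P else 0)
          + (if k = j then x i * x k / \<mu> else 0) - (x i * x j / (P * \<mu>)) * (x k * x k))"
      using assms P by (intro sum.cong) (auto simp: field_simps)
    also have "\<dots> = (if i = j then 1 else 0) - x i * x j / P + x i * x j / \<mu>
        - (x i * x j / (P * \<mu>)) * (P - \<mu>)"
      unfolding sum_subtractf sum.distrib S_scaled using that by simp
    also have "\<dots> = (if i = j then 1 else 0)"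
      using assms P by (simp add: field_simps)
    finally show ?thesis .
  qed
  show right: "rank_one_mat \<mu> x N * rank_one_inv \<mu> x N = 1\<^sub>m N"
    by (rule eq_matI)
      (use * in \<open>auto simp: rank_one_mat_def rank_one_inv_def scalar_prod_def P_def atLeast0LessThan\<close>)
  show "rank_one_inv \<mu> x N * rank_one_mat \<mu> x N = 1\<^sub>m N"
  proof -
    \<comment> \<open>Both matrices are symmetric, so transposing the first identity yields the
      second.\<close>
    have "(rank_one_mat \<mu> x N * rank_one_inv \<mu> x N)\<^sup>T
        = (rank_one_inv \<mu> x N)\<^sup>T * (rank_one_mat \<mu> x N)\<^sup>T"
      by (rule transpose_mult) (auto simp: rank_one_mat_def rank_one_inv_def)
    moreover have "(rank_one_inv \<mu> x N)\<^sup>T = rank_one_inv \<mu> x N"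
      by (rule eq_matI) (auto simp: rank_one_inv_def mult.commute)
    moreover have "(rank_one_mat \<mu> x N)\<^sup>T = rank_one_mat \<mu> x N"
      by (rule eq_matI) (auto simp: rank_one_mat_def mult.commute)
    ultimately show ?thesis using right by simp
  qed
qed

text \<open>For \<open>j \<le> i\<close> only columns up to \<open>j\<close> contribute to entry
  \<open>(i, j)\<close> of the product. Columns before \<open>j\<close> telescope to a multiple of
  \<open>1 / P j - 1 / P 0\<close>. Column \<open>j\<close> cancels the \<open>1 / P j\<close> part
  off the diagonal and completes it to \<open>1 / \<mu>\<close> on the diagonal.\<close>

lemma rank_one_chol_is_cholesky:
  assumes "\<mu> > 0"
  shows "is_cholesky_factor (rank_one_inv \<mu> x N) (rank_one_chol \<mu> x N)"
proof -
  define P where "P = tail_mass \<mu> x N"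
  define L where "L = rank_one_chol \<mu> x N"
  have P: "P s > 0" for s
    using tail_mass_ge[of \<mu> x N s] assms by (simp add: P_def)
  have P_Suc: "P s = P (Suc s) + (x s)\<^sup>2" if "s < N" for s
    using tail_mass_Suc[OF that] by (simp add: P_def)
  define l where "l s = sqrt (P (Suc s) / (\<mu> * P s))" for s
  have l2: "l s * l s = P (Suc s) / (\<mu> * P s)" for s
    using P[of s] P[of "Suc s"] assms by (simp add: l_def)
  have l: "l s > 0" for s
    using P[of s] P[of "Suc s"] assms by (simp add: l_def)
  have L: "L $$ (i, s) = l s * (if i < s then 0 else if i = s then 1 else - x i * x s / P (Suc s))"
    if "i < N" "s < N" for i s
    using that by (simp add: L_def rank_one_chol_def l_def P_def)
  have prod: "(\<Sum>s<N. L $$ (i, s) * L $$ (j, s)) =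
      ((if i = j then 1 else 0) - x i * x j / P 0) / \<mu>" if "j \<le> i" "i < N" for i j
  proof -
    have "(\<Sum>s<N. L $$ (i, s) * L $$ (j, s)) = (\<Sum>s<Suc j. L $$ (i, s) * L $$ (j, s))"
      by (rule sum.mono_neutral_right) (use that L in \<open>auto simp: not_less_eq\<close>)
    also have "\<dots> = (\<Sum>s<j. L $$ (i, s) * L $$ (j, s)) + L $$ (i, j) * L $$ (j, j)"
      by simp
    also have "(\<Sum>s<j. L $$ (i, s) * L $$ (j, s))
        = (\<Sum>s<j. x i * x j / \<mu> * ((x s)\<^sup>2 / (P s * P (Suc s))))"
    proof (intro sum.cong refl)
      fix s assume "s \<in> {..<j}"
      then have "L $$ (i, s) * L $$ (j, s) = l s * l s * (x i * x s / P (Suc s) * (x j * x s / P (Suc s)))"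
        using that by (simp add: L)
      then show "L $$ (i, s) * L $$ (j, s) = x i * x j / \<mu> * ((x s)\<^sup>2 / (P s * P (Suc s)))"
        unfolding l2 using P[of s] P[of "Suc s"] assms by (simp add: field_simps power2_eq_square)
    qed
    also have "\<dots> = x i * x j / \<mu> * (1 / P j - 1 / P 0)"
      unfolding sum_distrib_left[symmetric]
      using sum_telescope_tail_mass[of \<mu> j N x] that assms by (simp add: P_def)
    also have "L $$ (i, j) * L $$ (j, j) = l j * l j * (if i = j then 1 else - x i * x j / P (Suc j))"
      using that by (simp add: L)
    also have "x i * x j / \<mu> * (1 / P j - 1 / P 0) + \<dots>
        = ((if i = j then 1 else 0) - x i * x j / P 0) / \<mu>"
    proof (cases "i = j")
      case True
      have P_Suc': "P (Suc j) = P j - x j * x j"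
        using P_Suc[of j] that by (simp add: power2_eq_square)
      show ?thesis
        unfolding l2 P_Suc' using True P[of j] P[of 0] assms by (simp add: field_simps)
    next
      case False
      then show ?thesis
        unfolding l2 using P[of j] P[of 0] P[of "Suc j"] assms by (simp add: field_simps)
    qed
    finally show ?thesis .
  qed
  have "(\<Sum>s<N. L $$ (i, s) * L $$ (j, s)) =
      ((if i = j then 1 else 0) - x i * x j / P 0) / \<mu>" if "i < N" "j < N" for i j
    using prod[of j i] prod[of i j] that by (cases "j \<le> i") (auto simp: mult.commute)
  moreover have "L \<in> carrier_mat N N" by (simp add: L_def rank_one_chol_def)
  ultimately have "rank_one_inv \<mu> x N = L * L\<^sup>T"
    by (intro eq_matI) (auto simp: rank_one_inv_def scalar_prod_def P_def atLeast0LessThan)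
  with \<open>L \<in> carrier_mat N N\<close> show ?thesis
    unfolding is_cholesky_factor_def L_def[symmetric]
    using L l by (auto simp: rank_one_inv_def)
qed

text \<open>Every rounding error is prescribed to be 1/4, which is admissible as it is below 1/2.
  For positive \<open>x\<close> the corrections passed on to a coordinate then all have the same
  sign and cannot cancel.\<close>

lemma optq_rank_one:
  assumes "\<mu> > 0"
  obtains w q where "w \<in> carrier_vec N" "q \<in> carrier_vec N" "optq (rank_one_mat \<mu> x N) w q"
    "\<And>i. i < N \<Longrightarrow> \<bar>w $ i\<bar> \<le> 1 / 2"
    "\<And>i. i < N \<Longrightarrow> (w - q) $ i = (1 - x i * (\<Sum>s<i. x s / tail_mass \<mu> x N (Suc s))) / 4"
proof -
  define L where "L = rank_one_chol \<mu> x N"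
  have chol: "is_cholesky_factor (rank_one_inv \<mu> x N) L"
    unfolding L_def by (rule rank_one_chol_is_cholesky[OF assms])
  then have diag: "L $$ (i, i) > 0" if "i < N" for i
    using that by (simp add: is_cholesky_factor_def rank_one_inv_def)
  obtain w where w: "w \<in> carrier_vec N" "\<And>i. i < N \<Longrightarrow> \<bar>w $ i\<bar> \<le> 1 / 2"
    and err: "\<And>i. i < N \<Longrightarrow>
      (w - optq_result L w) $ i = 1 / 4 + (\<Sum>s<i. 1 / 4 * (L $$ (i, s) / L $$ (s, s)))"
    by (rule optq_rounding_errors_prescribed[of N "\<lambda>_. 1 / 4" L])
      (use diag less_imp_neq in \<open>fastforce+\<close>)
  have ratio: "L $$ (i, s) / L $$ (s, s) = - x i * x s / tail_mass \<mu> x N (Suc s)"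
    if "s < i" "i < N" for i s
    using that assms tail_mass_ge[of \<mu> x N s] tail_mass_ge[of \<mu> x N "Suc s"]
    by (auto simp: L_def rank_one_chol_def)
  have "(w - optq_result L w) $ i = (1 - x i * (\<Sum>s<i. x s / tail_mass \<mu> x N (Suc s))) / 4"
    if "i < N" for i
    using err[OF that] ratio that
    by (simp add: sum_negf sum_distrib_left sum_divide_distrib diff_divide_distrib
        mult.commute[of 4])
  moreover have "optq (rank_one_mat \<mu> x N) w (optq_result L w)"
    unfolding optq_def
    using w(1) chol rank_one_mat_inverse[OF assms, of x N]
    by (intro exI[of _ "rank_one_inv \<mu> x N"] exI[of _ L])
      (auto simp: inverts_mat_def rank_one_mat_def rank_one_inv_def)
  moreover have "optq_result L w \<in> carrier_vec N"
    using w(1) by (simp add: optq_result_def)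
  ultimately show thesis using that w by blast
qed

section \<open>The stacked matrix: Gram matrix, norms and action on vectors\<close>

text \<open>The diagonal block adds \<open>N * \<beta>^2\<close> to the squared Frobenius norm,
  hence \<open>\<alpha> * \<beta>^2\<close> to the regularization parameter, but at most
  \<open>\<beta>^2\<close> to the squared spectral norm.\<close>

definition stacked_mat :: "real \<Rightarrow> (nat \<Rightarrow> real) \<Rightarrow> nat \<Rightarrow> real mat" where
  "stacked_mat \<beta> x N = mat (Suc N) N (\<lambda>(i, j). if i = 0 then x j else if i = Suc j then \<beta> else 0)"

lemma stacked_mat_gram:
  "(stacked_mat \<beta> x N)\<^sup>T * stacked_mat \<beta> x N + l \<cdot>\<^sub>m 1\<^sub>m N = rank_one_mat (\<beta>\<^sup>2 + l) x N"
proof (rule eq_matI)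
  fix i j assume "i < dim_row (rank_one_mat (\<beta>\<^sup>2 + l) x N)" "j < dim_col (rank_one_mat (\<beta>\<^sup>2 + l) x N)"
  then have ij: "i < N" "j < N" by (auto simp: rank_one_mat_def)
  have "(\<Sum>k<N. (if k = i then \<beta> else 0) * (if k = j then \<beta> else 0)) = (if i = j then \<beta>\<^sup>2 else 0)"
  proof -
    have "(\<Sum>k<N. (if k = i then \<beta> else 0) * (if k = j then \<beta> else 0))
        = (\<Sum>k<N. if k = i then (if i = j then \<beta>\<^sup>2 else 0) else 0)"
      by (intro sum.cong) (auto simp: power2_eq_square)
    then show ?thesis using ij by simp
  qed
  then show "((stacked_mat \<beta> x N)\<^sup>T * stacked_mat \<beta> x N + l \<cdot>\<^sub>m 1\<^sub>m N) $$ (i, j)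
      = rank_one_mat (\<beta>\<^sup>2 + l) x N $$ (i, j)"
    using ij by (simp add: stacked_mat_def rank_one_mat_def scalar_prod_def
        atLeast0LessThan sum.lessThan_Suc_shift del: sum.lessThan_Suc)
qed (auto simp: stacked_mat_def rank_one_mat_def)

lemma stacked_mat_frobenius:
  "(frobenius_norm (stacked_mat \<beta> x N))\<^sup>2 = (\<Sum>j<N. (x j)\<^sup>2) + real N * \<beta>\<^sup>2"
proof -
  have "(\<Sum>j<N. (if i = j then \<beta> else 0)\<^sup>2) = \<beta>\<^sup>2" if "i < N" for i
  proof -
    have "(\<Sum>j<N. (if i = j then \<beta> else 0)\<^sup>2) = (\<Sum>j<N. if i = j then \<beta>\<^sup>2 else 0)"
      by (intro sum.cong) auto
    then show ?thesis using that by simp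
  qed
  then show ?thesis
    unfolding frobenius_norm_def
    by (subst real_sqrt_pow2)
      (auto intro!: add_nonneg_nonneg sum_nonneg simp: stacked_mat_def sum.lessThan_Suc_shift simp del: sum.lessThan_Suc)
qed

lemma stacked_mat_mult_vec:
  assumes "v \<in> carrier_vec N"
  shows "(stacked_mat \<beta> x N *\<^sub>v v) $ 0 = (\<Sum>j<N. x j * v $ j)"
    and "i < N \<Longrightarrow> (stacked_mat \<beta> x N *\<^sub>v v) $ Suc i = \<beta> * v $ i"
proof -
  show "(stacked_mat \<beta> x N *\<^sub>v v) $ 0 = (\<Sum>j<N. x j * v $ j)"
    using assms by (simp add: stacked_mat_def scalar_prod_def atLeast0LessThan)
  assume i: "i < N"
  have "(stacked_mat \<beta> x N *\<^sub>v v) $ Suc i = (\<Sum>j<N. (if i = j then \<beta> else 0) * v $ j)"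
    using assms i by (simp add: stacked_mat_def scalar_prod_def atLeast0LessThan)
  also have "\<dots> = (\<Sum>j<N. if i = j then \<beta> * v $ j else 0)"
    by (intro sum.cong) auto
  finally show "(stacked_mat \<beta> x N *\<^sub>v v) $ Suc i = \<beta> * v $ i"
    using i by simp
qed

text \<open>Cauchy-Schwarz bounds the first coordinate of the image; the others contribute exactly
  \<open>\<beta>^2\<close> times the squared norm of \<open>v\<close>.\<close>

lemma stacked_mat_spectral_norm:
  "spectral_norm (stacked_mat \<beta> x N) \<le> sqrt ((\<Sum>j<N. (x j)\<^sup>2) + \<beta>\<^sup>2)"
  unfolding spectral_norm_def
proof (rule cSup_least)
  show "{l2_norm_vec (stacked_mat \<beta> x N *\<^sub>v v) | v.
      v \<in> carrier_vec (dim_col (stacked_mat \<beta> x N)) \<and> l2_norm_vec v \<le> 1} \<noteq> {}"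
    by (auto intro!: exI[of _ "0\<^sub>v (dim_col (stacked_mat \<beta> x N))"] simp: l2_norm_vec_def)
next
  fix r assume "r \<in> {l2_norm_vec (stacked_mat \<beta> x N *\<^sub>v v) | v.
      v \<in> carrier_vec (dim_col (stacked_mat \<beta> x N)) \<and> l2_norm_vec v \<le> 1}"
  then obtain v where r: "r = l2_norm_vec (stacked_mat \<beta> x N *\<^sub>v v)"
    and v: "v \<in> carrier_vec N" and "l2_norm_vec v \<le> 1"
    by (auto simp: stacked_mat_def)
  then have v1: "(\<Sum>j<N. (v $ j)\<^sup>2) \<le> 1"
    by (simp add: l2_norm_vec_def)
  have "dim_vec (stacked_mat \<beta> x N *\<^sub>v v) = Suc N" by (simp add: stacked_mat_def)
  then have "(\<Sum>i<dim_vec (stacked_mat \<beta> x N *\<^sub>v v). ((stacked_mat \<beta> x N *\<^sub>v v) $ i)\<^sup>2)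
      = (\<Sum>j<N. x j * v $ j)\<^sup>2 + (\<Sum>i<N. (\<beta> * v $ i)\<^sup>2)"
    using stacked_mat_mult_vec[OF v, where \<beta> = \<beta> and x = x]
    by (simp add: sum.lessThan_Suc_shift del: sum.lessThan_Suc index_mult_mat_vec)
  also have "\<dots> \<le> (\<Sum>j<N. (x j)\<^sup>2) * (\<Sum>j<N. (v $ j)\<^sup>2) + \<beta>\<^sup>2 * (\<Sum>j<N. (v $ j)\<^sup>2)"
    using Cauchy_Schwarz_ineq_sum[of x "\<lambda>j. v $ j" "{..<N}"]
    by (simp add: power_mult_distrib sum_distrib_left)
  also have "\<dots> = ((\<Sum>j<N. (x j)\<^sup>2) + \<beta>\<^sup>2) * (\<Sum>j<N. (v $ j)\<^sup>2)"
    by (simp add: algebra_simps)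
  also have "\<dots> \<le> ((\<Sum>j<N. (x j)\<^sup>2) + \<beta>\<^sup>2) * 1"
    using v1 by (intro mult_left_mono add_nonneg_nonneg sum_nonneg) auto
  finally show "r \<le> sqrt ((\<Sum>j<N. (x j)\<^sup>2) + \<beta>\<^sup>2)"
    by (simp add: r l2_norm_vec_def)
qed

lemma linf_norm_vec_ge: "i < dim_vec v \<Longrightarrow> \<bar>v $ i\<bar> \<le> linf_norm_vec v"
  unfolding linf_norm_vec_def by (intro Max_ge) auto

lemma linf_norm_vec_le:
  "0 \<le> b \<Longrightarrow> (\<And>i. i < dim_vec v \<Longrightarrow> \<bar>v $ i\<bar> \<le> b) \<Longrightarrow> linf_norm_vec v \<le> b"
  unfolding linf_norm_vec_def by (subst Max_le_iff) auto

section \<open>Choice of parameters and the two lower bounds\<close>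

lemma optq_large_error_instance:
  fixes \<alpha> :: real and N :: nat
  assumes \<alpha>: "\<alpha> > 0" "\<alpha> \<le> real N" and N: "N \<ge> 1"
  shows "\<exists>m. \<exists>X \<in> carrier_mat m N. \<exists>w \<in> carrier_vec N. \<exists>q lam.
           lam = \<alpha> * (frobenius_norm X)\<^sup>2 / real N \<and> lam > 0 \<and>
           optq (X\<^sup>T * X + lam \<cdot>\<^sub>m 1\<^sub>m N) w q \<and>
           linf_norm_vec (w - q) \<ge> 1 / 80 * sqrt (real N) \<and>
           linf_norm_vec (X *\<^sub>v (w - q)) \<ge> 1 / 80 * sqrt (real N) \<and>
           spectral_norm X \<le> 2 \<and>
           linf_norm_vec w \<le> 1 / 2"
proof -
  define r where "r = sqrt (real N)"
  have r1: "r \<ge> 1" and rr: "r * r = real N" using N by (auto simp: r_def)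
  define x where "x i = (if Suc i = N then 1 else 1 / r)" for i
  obtain n where n: "N = Suc n" using N by (cases N) auto
  have mass: "(\<Sum>j<N. (x j)\<^sup>2) = real n / real N + 1"
    using r1 by (simp add: n x_def power_divide r_def)
  define K where "K = (\<Sum>j<N. (x j)\<^sup>2)"
  have K: "K \<ge> 1" "K \<le> 2" unfolding K_def mass using N by (auto simp: n field_simps)
  \<comment> \<open>With this choice \<open>\<beta>^2 + \<alpha> * \<beta>^2 = 1\<close>, so the
    diagonal shift \<open>\<mu>\<close> is \<open>1 + \<alpha> * K / N\<close>, at most 3 when
    \<open>\<alpha> \<le> N\<close>.\<close>
  define \<beta> where "\<beta> = sqrt (1 / (1 + \<alpha>))"
  have \<beta>2: "\<beta>\<^sup>2 = 1 / (1 + \<alpha>)" using \<alpha> by (simp add: \<beta>_def)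
  define X where "X = stacked_mat \<beta> x N"
  define lam where "lam = \<alpha> * (frobenius_norm X)\<^sup>2 / real N"
  have "lam = \<alpha> * K / real N + \<alpha> * \<beta>\<^sup>2"
    using N by (simp add: lam_def X_def stacked_mat_frobenius K_def field_simps)
  moreover have "\<alpha> * K / real N > 0" using \<alpha> N K by simp
  moreover have "\<beta>\<^sup>2 + \<alpha> * \<beta>\<^sup>2 = 1"
    using \<alpha> by (simp add: \<beta>2 flip: add_divide_distrib)
  ultimately have lam_pos: "lam > 0" and mu_eq: "\<beta>\<^sup>2 + lam = 1 + \<alpha> / real N * K"
    using \<alpha> by (simp_all add: add_pos_nonneg)
  define \<mu> where "\<mu> = \<beta>\<^sup>2 + lam"
  have "\<alpha> / real N * K \<le> 1 * 2"
    using \<alpha> N K by (intro mult_mono) auto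
  then have \<mu>: "\<mu> \<ge> 1" "\<mu> \<le> 3"
    using \<alpha> K unfolding \<mu>_def mu_eq by auto
  then have \<mu>_pos: "\<mu> > 0" by simp
  obtain w q where w: "w \<in> carrier_vec N" and q: "q \<in> carrier_vec N"
    and optq: "optq (rank_one_mat \<mu> x N) w q"
    and w_le: "\<And>i. i < N \<Longrightarrow> \<bar>w $ i\<bar> \<le> 1 / 2"
    and err: "\<And>i. i < N \<Longrightarrow>
      (w - q) $ i = (1 - x i * (\<Sum>s<i. x s / tail_mass \<mu> x N (Suc s))) / 4"
    using optq_rank_one[OF \<mu>_pos, of N x] by blast
  \<comment> \<open>The 5 comes from \<open>\<mu> \<le> 3\<close> and \<open>K \<le> 2\<close>. The
    last entry of \<open>x\<close> is 1, which is also at least \<open>1 / r\<close>.\<close>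
  have term_ge: "1 / r / 5 \<le> x s / tail_mass \<mu> x N (Suc s)" for s
  proof (rule frac_le)
    show "1 / r \<le> x s" "0 \<le> x s" using r1 by (auto simp: x_def)
    show "tail_mass \<mu> x N (Suc s) \<le> 5"
      using tail_mass_le[of \<mu> x N "Suc s"] \<mu> K by (simp add: K_def)
    show "0 < tail_mass \<mu> x N (Suc s)"
      using tail_mass_ge[of \<mu> x N "Suc s"] \<mu> by linarith
  qed
  have sum_ge: "real k * (1 / r / 5) \<le> (\<Sum>s<k. x s / tail_mass \<mu> x N (Suc s))" for k
    using sum_mono[of "{..<k}" "\<lambda>_. 1 / r / 5" "\<lambda>s. x s / tail_mass \<mu> x N (Suc s)"] term_ge
    by simp
  have wq: "w - q \<in> carrier_vec N" using w q by simp
  have err_le: "\<bar>(w - q) $ i\<bar> \<le> linf_norm_vec (w - q)" if "i < N" for i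
    using q that by (intro linf_norm_vec_ge) auto
  \<comment> \<open>Coordinate 0 receives no corrections and has error 1/4, enough while
    \<open>r \<le> 20\<close>. Beyond that, the last coordinate has accumulated
    \<open>n = N - 1\<close> corrections, so its error is at most \<open>(6 - r) / 20\<close>, which
    is below \<open>- r / 80\<close>.\<close>
  have e_large: "linf_norm_vec (w - q) \<ge> 1 / 80 * r"
  proof (cases "r \<le> 20")
    case True
    have "\<bar>(w - q) $ 0\<bar> = 1 / 4" using err[of 0] N by simp
    then show ?thesis
      using True err_le[of 0] N by linarith
  next
    case False
    have "real n = r * r - 1" using rr n by simp
    then have "real n * (1 / r / 5) = (r - 1 / r) / 5"
      using False by (simp add: field_simps)
    moreover have "1 / r \<le> 1" using r1 by simp
    ultimately have "(r - 1) / 5 \<le> real n * (1 / r / 5)" by simp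
    then have "(r - 1) / 5 \<le> (\<Sum>s<n. x s / tail_mass \<mu> x N (Suc s))"
      using sum_ge[of n] by (rule order_trans)
    then have "(w - q) $ n \<le> (1 - (r - 1) / 5) / 4"
      using err[of n] n by (simp add: x_def)
    also have "\<dots> \<le> - (1 / 80 * r)" using False by (simp add: field_simps)
    finally have "\<bar>(w - q) $ n\<bar> \<ge> 1 / 80 * r" by linarith
    then show ?thesis
      using err_le[of n] n by linarith
  qed
  have "(X *\<^sub>v (w - q)) $ 0 =
      (\<Sum>i<N. x i * (1 - x i * (\<Sum>s<i. x s / tail_mass \<mu> x N (Suc s)))) / 4"
    unfolding X_def stacked_mat_mult_vec(1)[OF wq] sum_divide_distrib
    by (intro sum.cong) (auto simp: err)
  \<comment> \<open>At \<open>n = N\<close> the tail mass is just \<open>\<mu>\<close>, and what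
    remains is a sum of \<open>N\<close> positive terms.\<close>
  also have "\<dots> = \<mu> * (\<Sum>s<N. x s / tail_mass \<mu> x N (Suc s)) / 4"
    using sum_weighted_error[of \<mu> N N x] \<mu> by simp
  also have "\<dots> \<ge> 1 * (real N * (1 / r / 5)) / 4"
    using sum_ge[of N] \<mu> r1 by (intro divide_right_mono mult_mono) auto
  also have "1 * (real N * (1 / r / 5)) / 4 = r / 20"
    using r1 by (simp flip: rr)
  finally have "1 / 80 * r \<le> \<bar>(X *\<^sub>v (w - q)) $ 0\<bar>" using r1 by linarith
  then have Xe_large: "linf_norm_vec (X *\<^sub>v (w - q)) \<ge> 1 / 80 * r"
    using linf_norm_vec_ge[of 0 "X *\<^sub>v (w - q)"] by (simp add: X_def stacked_mat_def)
  have "\<beta>\<^sup>2 \<le> 1" using \<alpha> by (simp add: \<beta>2)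
  then have "sqrt (K + \<beta>\<^sup>2) \<le> sqrt 4" using K by (intro real_sqrt_le_mono) linarith
  then have "spectral_norm X \<le> 2"
    using stacked_mat_spectral_norm[of \<beta> x N] by (simp add: X_def K_def)
  moreover have "linf_norm_vec w \<le> 1 / 2"
    using w w_le by (intro linf_norm_vec_le) auto
  moreover have "optq (X\<^sup>T * X + lam \<cdot>\<^sub>m 1\<^sub>m N) w q"
    using optq by (simp add: X_def stacked_mat_gram \<mu>_def)
  moreover have "X \<in> carrier_mat (Suc N) N" by (simp add: X_def stacked_mat_def)
  ultimately show ?thesis
    using w lam_pos lam_def e_large Xe_large unfolding r_def by blast
qed

theorem mainTheorem4:
  shows "\<exists>c C \<delta> :: real. c > 0 \<and> C > 0 \<and> \<delta> > 0 \<and>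
    (\<forall>\<alpha>::real. \<alpha> > 0 \<longrightarrow>
      (\<forall>N::nat. N \<ge> 1 \<and> \<alpha> \<le> \<delta> * real N \<longrightarrow>
        (\<exists>m. \<exists>X \<in> carrier_mat m N. \<exists>w \<in> carrier_vec N. \<exists>q lam.
           lam = \<alpha> * (frobenius_norm X)\<^sup>2 / real N \<and> lam > 0 \<and>
           optq (X\<^sup>T * X + lam \<cdot>\<^sub>m 1\<^sub>m N) w q \<and>
           linf_norm_vec (w - q) \<ge> c * sqrt (real N) \<and>
           linf_norm_vec (X *\<^sub>v (w - q)) \<ge> c * sqrt (real N) \<and>
           spectral_norm X \<le> C \<and>
           linf_norm_vec w \<le> 1 / 2)))"
  \<comment> \<open>With \<open>\<delta> = 1\<close> the smallness condition reads
    \<open>\<alpha> \<le> N\<close>.\<close>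
  by (rule exI[of _ "1 / 80"], rule exI[of _ 2], rule exI[of _ 1])
    (use optq_large_error_instance in simp)

end
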